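(* Let $n\ge1$ and let $f=(f_1,\ldots,f_n):\mathbb{R}^n\to\mathbb{R}^n$ be a polynomial map with no zeros at infinity. If the Jacobian matrix $J(f)(x)$ does not have $1$ as an eigenvalue at any point $x\in\mathbb{R}^n$ (for example, $J(f)$ is nilpotent), then $f$ has a unique fixed point.
   Context: The algebraic degree of $f$ is $d=\max_i d_i$, where $d_i$ is the total degree of $f_i$. "$f$ has no zeros at infinity" means that the homogeneous parts of degree $d$ of the components $f_1,\ldots,f_n$ (the homogeneous part being identically zero for those $i$ with $d_i<d$) have no common zero in $\mathbb{R}^n\setminus\{0\}$. *)

theory Defs
  imports "HOL-Analysis.Analysis" "HOL-Library.Poly_Mapping"
begin

text \<open>
  Real polynomials in variables indexed by the finite type \<^typ>\<open>'n\<close>: finitely supported maps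
  from exponent vectors to coefficients.
\<close>

type_synonym 'n rpoly = "('n \<Rightarrow>\<^sub>0 nat) \<Rightarrow>\<^sub>0 real"

definition poly_eval :: "'n::finite rpoly \<Rightarrow> real ^ 'n \<Rightarrow> real" where
  "poly_eval p x =
     (\<Sum>m\<in>Poly_Mapping.keys p.
        Poly_Mapping.lookup p m * (\<Prod>i\<in>UNIV. (x $ i) ^ Poly_Mapping.lookup m i))"

definition mon_degree :: "('n::finite \<Rightarrow>\<^sub>0 nat) \<Rightarrow> nat" where
  "mon_degree m = (\<Sum>i\<in>UNIV. Poly_Mapping.lookup m i)"

text \<open>
  The zero polynomial gets total degree 0.  All its homogeneous parts vanish, so another
  convention would not change which maps have no zeros at infinity.
\<close>

definition total_degree :: "'n::finite rpoly \<Rightarrow> nat" where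
  "total_degree p = Max (insert 0 (mon_degree ` Poly_Mapping.keys p))"

definition hom_part :: "nat \<Rightarrow> 'n::finite rpoly \<Rightarrow> 'n rpoly" where
  "hom_part d p =
     (\<Sum>m\<in>{m \<in> Poly_Mapping.keys p. mon_degree m = d}.
        Poly_Mapping.single m (Poly_Mapping.lookup p m))"

text \<open>
  A polynomial map of real n-space to itself is given by its components \<^term>\<open>f i\<close>.  As the
  field is infinite, the components are determined by the function \<open>poly_map f\<close>.
\<close>

definition poly_map :: "('n::finite \<Rightarrow> 'n rpoly) \<Rightarrow> real ^ 'n \<Rightarrow> real ^ 'n" where
  "poly_map f x = (\<chi> i. poly_eval (f i) x)"

definition alg_degree :: "('n::finite \<Rightarrow> 'n rpoly) \<Rightarrow> nat" where
  "alg_degree f = Max {total_degree (f i) | i. i \<in> UNIV}"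

definition no_zeros_at_infinity :: "('n::finite \<Rightarrow> 'n rpoly) \<Rightarrow> bool" where
  "no_zeros_at_infinity f \<longleftrightarrow>
     \<not> (\<exists>x. x \<noteq> 0 \<and> (\<forall>i. poly_eval (hom_part (alg_degree f) (f i)) x = 0))"

definition eigenvalue :: "real ^ 'n ^ 'n \<Rightarrow> real \<Rightarrow> bool" where
  "eigenvalue A c \<longleftrightarrow> (\<exists>v. v \<noteq> 0 \<and> A *v v = c *\<^sub>R v)"

definition nilpotent :: "real ^ 'n ^ 'n \<Rightarrow> bool" where
  "nilpotent A \<longleftrightarrow> (\<exists>k. (((**) A) ^^ k) (mat 1) = 0)"

end

theory Submission
  imports Defs
begin

text \<open>
  Fixed points of a polynomial map \<open>f\<close> are the zeros of \<open>F x = x - f x\<close>, and the theorem follows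
  because \<open>F\<close> is even a bijection.  The hypothesis on the eigenvalue says exactly that the derivative
  of \<open>F\<close>, the identity minus the Jacobian matrix of \<open>f\<close>, is injective everywhere, so \<open>F\<close> is a local
  diffeomorphism.  Hadamard's global inverse theorem (\<open>proper_local_diffeomorphism_imp_bij\<close>) turns
  this into bijectivity once \<open>F\<close> is known to be proper: a proper local homeomorphism of Euclidean
  space is a covering map, and a covering of a simply connected space by a connected one has only
  one sheet.

  Properness comes from the behaviour at infinity.  Let \<open>d\<close> be the algebraic degree of \<open>f\<close>.  The
  part of \<open>f\<close> that is homogeneous of degree \<open>d\<close> has no zero on the compact unit sphere, so it grows
  at least like a positive multiple of the \<open>d\<close>-th power of the norm, whereas the rest of \<open>f\<close> has
  order at most \<open>d - 1\<close>.  If \<open>d \<ge> 2\<close>, the identity also has order at most \<open>d - 1\<close>, so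
  \<open>F\<close> tends to infinity at infinity (\<open>filterlim_id_minus_poly_map\<close>).

  If \<open>d = 1\<close>, the identity can cancel the leading part of \<open>f\<close>, and this argument breaks down.  But
  for \<open>d \<le> 1\<close> the map \<open>F\<close> is affine, and its linear part is its derivative, which is injective and
  hence bijective (\<open>bij_affine\<close>).
\<close>

section \<open>Proper local homeomorphisms of Euclidean space\<close>

text \<open>
  The fibre over \<open>y\<close> is compact because \<open>f\<close> is proper, and discrete because \<open>f\<close> is locally
  injective; so it is finite.  Small disjoint balls around its points are mapped homeomorphically
  onto neighbourhoods of \<open>y\<close>, by invariance of domain.  Outside these balls \<open>f\<close> stays away from
  \<open>y\<close>, as a proper map is closed, so a small neighbourhood of \<open>y\<close> is evenly covered.  Surjectivity
  holds because the image is open and closed.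
\<close>
lemma covering_space_proper_locally_injective:
  fixes f :: "'a::euclidean_space \<Rightarrow> 'a"
  assumes cont: "continuous_on UNIV f"
    and proper: "\<And>K. compact K \<Longrightarrow> compact (f -` K)"
    and locinj: "\<And>x. \<exists>r>0. inj_on f (ball x r)"
  shows "covering_space UNIV f UNIV"
proof
  obtain r where r: "\<And>x. r x > 0" "\<And>x. inj_on f (ball x (r x))"
    using locinj by metis
  have closed_map: "closed (f ` C)" if "closed C" for C
    using proper_map[of UNIV C UNIV f] that proper by simp
  have open_image: "open (f ` U)" if "open U" "inj_on f U" for U
    using invariance_of_domain[of U f] that continuous_on_subset[OF cont] by blast
  have "open (f ` UNIV)"
  proof -
    have "f ` UNIV = (\<Union>x. f ` ball x (r x))"
      using r(1) centre_in_ball by blast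
    also have "open \<dots>"
      using open_image r(2) by blast
    finally show ?thesis .
  qed
  then show "f ` UNIV = UNIV"
    using closed_map[of UNIV] clopen[of "f ` UNIV"] by auto
  fix y
  define S where "S = f -` {y}"
  have "compact S"
    unfolding S_def by (rule proper) simp
  moreover have "\<not> x islimpt S" for x
  proof
    assume "x islimpt S"
    then have "infinite (S \<inter> ball x (r x))"
      by (simp add: islimpt_eq_infinite_ball r(1))
    moreover have "S \<inter> ball x (r x) \<subseteq> {z}" if "z \<in> S \<inter> ball x (r x)" for z
      using that r(2)[of x] by (auto simp: S_def inj_on_def)
    ultimately show False
      by (metis finite.emptyI finite_subset finite_insert ex_in_conv)
  qed
  ultimately have "finite S"
    using Heine_Borel_imp_Bolzano_Weierstrass by blast
  \<comment> \<open>One radius for the whole fibre, at most half of every distance between two of its points.\<close>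
  obtain e where "e > 0" and e_inj: "\<And>x. x \<in> S \<Longrightarrow> inj_on f (ball x e)"
    and e_disj: "\<And>x x'. x \<in> S \<Longrightarrow> x' \<in> S \<Longrightarrow> x \<noteq> x' \<Longrightarrow> ball x e \<inter> ball x' e = {}"
  proof -
    have "\<forall>x. \<exists>d>0. \<forall>x'\<in>S. x' \<noteq> x \<longrightarrow> d \<le> dist x x'"
      using finite_set_avoid[OF \<open>finite S\<close>] by blast
    then obtain d where d: "\<And>x. d x > 0" "\<And>x x'. x' \<in> S \<Longrightarrow> x' \<noteq> x \<Longrightarrow> d x \<le> dist x x'"
      by metis
    define e where "e = Min (insert 1 ((\<lambda>x. min (r x) (d x / 2)) ` S))"
    have "e > 0"
      unfolding e_def using \<open>finite S\<close> r(1) d(1) by auto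
    moreover have e_le: "e \<le> r x" "e \<le> d x / 2" if "x \<in> S" for x
    proof -
      have "e \<le> min (r x) (d x / 2)"
        unfolding e_def using \<open>finite S\<close> that by (intro Min_le) auto
      then show "e \<le> r x" "e \<le> d x / 2"
        by auto
    qed
    moreover have "inj_on f (ball x e)" if "x \<in> S" for x
      using inj_on_subset[OF r(2)[of x]] e_le(1)[OF that] by (simp add: subset_ball)
    moreover have "ball x e \<inter> ball x' e = {}" if "x \<in> S" "x' \<in> S" "x \<noteq> x'" for x x'
      using d(2)[of x' x] e_le(2)[OF that(1)] that by (intro disjoint_ballI) auto
    ultimately show ?thesis
      using that by blast
  qed
  define W where "W = (\<Union>x\<in>S. ball x e)"
  \<comment> \<open>Removing the image of the complement of the balls makes \<open>T\<close> evenly covered: no sheet over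
     \<open>T\<close> is missing from the balls.\<close>
  define T where "T = (\<Inter>x\<in>S. f ` ball x e) - f ` (- W)"
  have "y \<in> T"
  proof -
    have "y \<in> f ` ball x e" if "x \<in> S" for x
      using that \<open>e > 0\<close> by (auto simp: S_def intro!: image_eqI[of _ f x])
    moreover have "y \<notin> f ` (- W)"
    proof
      assume "y \<in> f ` (- W)"
      then obtain x where "x \<in> S" "x \<notin> W"
        by (auto simp: S_def)
      then show False
        using \<open>e > 0\<close> by (auto simp: W_def)
    qed
    ultimately show ?thesis
      by (simp add: T_def)
  qed
  have "open T"
    unfolding T_def using \<open>finite S\<close> e_inj
    by (intro open_Diff open_INT closed_map ballI open_image) (auto simp: W_def)
  have T_sub: "f -` T \<subseteq> W"
    by (auto simp: T_def)
  define v where "v = (\<lambda>x. ball x e \<inter> f -` T) ` S"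
  have "\<Union> v = UNIV \<inter> f -` T"
    using T_sub by (auto simp: v_def W_def)
  moreover have open_v: "open u" if "u \<in> v" for u
    using that \<open>open T\<close> open_vimage[OF _ cont] by (auto simp: v_def)
  moreover have "pairwise disjnt v"
    using e_disj unfolding v_def pairwise_image by (fastforce simp: pairwise_def disjnt_def)
  moreover have "\<exists>q. homeomorphism u T f q" if u: "u \<in> v" for u
  proof -
    obtain x where x: "x \<in> S" "u = ball x e \<inter> f -` T"
      using u by (auto simp: v_def)
    have "T \<subseteq> f ` ball x e"
      using x(1) by (auto simp: T_def)
    then have "f ` u = T"
      using x(2) by blast
    moreover have "inj_on f u"
      using e_inj[OF x(1)] x(2) by (auto intro: inj_on_subset)
    ultimately show ?thesis
      using invariance_of_domain_homeomorphism[of u f] open_v[OF u]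
        continuous_on_subset[OF cont, of u] by (metis order_refl subset_UNIV)
  qed
  ultimately show "\<exists>T. y \<in> T \<and> openin (top_of_set UNIV) T \<and>
      (\<exists>v. \<Union> v = UNIV \<inter> f -` T \<and> (\<forall>u\<in>v. openin (top_of_set UNIV) u) \<and>
           pairwise disjnt v \<and> (\<forall>u\<in>v. \<exists>q. homeomorphism u T f q))"
    using \<open>y \<in> T\<close> \<open>open T\<close> by (metis open_openin subtopology_UNIV)
qed (rule cont)

text \<open>
  For injectivity, lift the identity of the simply connected target to a section \<open>g\<close> with
  \<open>g (f a) = a\<close>.  Then \<open>g \<circ> f\<close> and the identity are both lifts of \<open>f\<close> through \<open>f\<close>
  that agree at \<open>a\<close>, hence everywhere, because the source is connected.
\<close>
lemma covering_space_simply_connected_imp_bij: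
  fixes f :: "'a::real_normed_vector \<Rightarrow> 'b::real_normed_vector"
  assumes cov: "covering_space UNIV f UNIV"
  shows "bij f"
proof (rule bijI)
  show "surj f"
    using covering_space_imp_surjective[OF cov] .
  have cont: "continuous_on UNIV f"
    using covering_space_imp_continuous[OF cov] .
  show "inj f"
  proof (rule injI)
    fix a b assume eq: "f a = f b"
    have "simply_connected (UNIV :: 'b set)" "locally path_connected (UNIV :: 'b set)"
      by (auto intro: convex_imp_simply_connected convex_imp_locally_path_connected)
    then obtain g where g: "continuous_on UNIV g" "g (f a) = a" "\<And>y. f (g y) = y"
      using covering_space_lift_strong[OF cov, of a "f a" UNIV "\<lambda>y. y"]
      by (metis UNIV_I Pi_I continuous_on_id)
    have "g (f b) = b"
    proof (rule covering_space_lift_unique[OF cov, of "\<lambda>x. g (f x)" a "\<lambda>x. x" UNIV f b])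
      show "continuous_on UNIV (\<lambda>x. g (f x))"
        using continuous_on_compose2[OF g(1) cont] by auto
    qed (auto simp: g cont)
    with g(2) eq show "a = b"
      by simp
  qed
qed

lemma compact_vimage_filterlim_at_infinity:
  fixes f :: "'a::euclidean_space \<Rightarrow> 'b::real_normed_vector"
  assumes cont: "continuous_on UNIV f" and lim: "LIM x at_infinity. f x :> at_infinity"
    and "compact K"
  shows "compact (f -` K)"
proof -
  obtain B where B: "\<And>y. y \<in> K \<Longrightarrow> norm y \<le> B"
    using compact_imp_bounded[OF \<open>compact K\<close>] by (auto simp: bounded_iff)
  have "\<forall>\<^sub>F y in at_infinity. norm (y :: 'b) \<ge> B + 1"
    by (auto simp: eventually_at_infinity)
  then have "\<forall>\<^sub>F x in at_infinity. norm (f x) \<ge> B + 1"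
    by (rule eventually_compose_filterlim[OF _ lim])
  then obtain R where "\<And>x. R \<le> norm x \<Longrightarrow> norm (f x) \<ge> B + 1"
    by (auto simp: eventually_at_infinity)
  with B have "norm x \<le> R" if "f x \<in> K" for x
    using that by (smt (verit))
  then have "bounded (f -` K)"
    by (auto simp: bounded_iff)
  moreover have "closed (f -` K)"
    using cont compact_imp_closed[OF \<open>compact K\<close>] by (simp add: closed_vimage)
  ultimately show ?thesis
    by (simp add: compact_eq_bounded_closed)
qed

section \<open>Continuously differentiable maps and global inversion\<close>

text \<open>
  The derivative is a map into the normed space of bounded linear functions, because this is the
  form in which the inverse function theorem needs its continuity.
\<close>
definition C1_map :: "('a::real_normed_vector \<Rightarrow> 'b::real_normed_vector) \<Rightarrow> bool" where
  "C1_map f \<longleftrightarrow> (\<exists>f'. (\<forall>x. (f has_derivative blinfun_apply (f' x)) (at x)) \<and> continuous_on UNIV f')"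

lemma C1_mapI:
  assumes "\<And>x. (f has_derivative blinfun_apply (f' x)) (at x)" and "continuous_on UNIV f'"
  shows "C1_map f"
  using assms unfolding C1_map_def by blast

lemma C1_map_imp_continuous_on: "C1_map f \<Longrightarrow> continuous_on UNIV f"
  unfolding C1_map_def by (meson has_derivative_continuous continuous_at_imp_continuous_on)

lemma C1_map_imp_differentiable: "C1_map f \<Longrightarrow> f differentiable (at x)"
  unfolding C1_map_def differentiable_def by blast

lemma C1_map_const: "C1_map (\<lambda>x. c)"
  unfolding C1_map_def by (rule exI[of _ "\<lambda>x. 0"]) (auto simp: zero_blinfun.rep_eq)

lemma C1_map_bounded_linear: "bounded_linear f \<Longrightarrow> C1_map f"
  unfolding C1_map_def
  by (rule exI[of _ "\<lambda>x. Blinfun f"])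
    (auto simp: bounded_linear_Blinfun_apply bounded_linear_imp_has_derivative)

lemma C1_map_bounded_linear_compose:
  assumes "bounded_linear h" "C1_map f"
  shows "C1_map (\<lambda>x. h (f x))"
proof -
  obtain f' where f': "\<And>x. (f has_derivative blinfun_apply (f' x)) (at x)" "continuous_on UNIV f'"
    using assms(2) unfolding C1_map_def by blast
  show ?thesis
  proof (rule C1_mapI)
    have "blinfun_apply (Blinfun h o\<^sub>L f' x) = (\<lambda>y. h (blinfun_apply (f' x) y))" for x
      by (simp add: fun_eq_iff bounded_linear_Blinfun_apply[OF assms(1)])
    then show "((\<lambda>x. h (f x)) has_derivative blinfun_apply (Blinfun h o\<^sub>L f' x)) (at x)" for x
      using bounded_linear.has_derivative[OF assms(1) f'(1)[of x]] by simp
    show "continuous_on UNIV (\<lambda>x. Blinfun h o\<^sub>L f' x)"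
      by (intro continuous_intros f'(2))
  qed
qed

lemma C1_map_add:
  assumes "C1_map f" "C1_map g"
  shows "C1_map (\<lambda>x. f x + g x)"
proof -
  obtain f' g' where
      f': "\<And>x. (f has_derivative blinfun_apply (f' x)) (at x)" "continuous_on UNIV f'"
    and g': "\<And>x. (g has_derivative blinfun_apply (g' x)) (at x)" "continuous_on UNIV g'"
    using assms unfolding C1_map_def by blast
  show ?thesis
  proof (rule C1_mapI)
    show "((\<lambda>x. f x + g x) has_derivative blinfun_apply (f' x + g' x)) (at x)" for x
      using has_derivative_add[OF f'(1)[of x] g'(1)[of x]] by (simp add: plus_blinfun.rep_eq)
    show "continuous_on UNIV (\<lambda>x. f' x + g' x)"
      by (intro continuous_intros f'(2) g'(2))
  qed
qed

lemma C1_map_mult: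
  fixes f g :: "'a::real_normed_vector \<Rightarrow> real"
  assumes "C1_map f" "C1_map g"
  shows "C1_map (\<lambda>x. f x * g x)"
proof -
  obtain f' g' where
      f': "\<And>x. (f has_derivative blinfun_apply (f' x)) (at x)" "continuous_on UNIV f'"
    and g': "\<And>x. (g has_derivative blinfun_apply (g' x)) (at x)" "continuous_on UNIV g'"
    using assms unfolding C1_map_def by blast
  show ?thesis
  proof (rule C1_mapI)
    show "((\<lambda>x. f x * g x) has_derivative blinfun_apply (f x *\<^sub>R g' x + g x *\<^sub>R f' x)) (at x)" for x
      using has_derivative_mult[OF f'(1)[of x] g'(1)[of x]]
      by (simp add: plus_blinfun.rep_eq scaleR_blinfun.rep_eq mult.commute)
    show "continuous_on UNIV (\<lambda>x. f x *\<^sub>R g' x + g x *\<^sub>R f' x)"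
      by (intro continuous_intros f'(2) g'(2) assms[THEN C1_map_imp_continuous_on])
  qed
qed

lemma C1_map_sum: "(\<And>i. i \<in> I \<Longrightarrow> C1_map (f i)) \<Longrightarrow> C1_map (\<lambda>x. \<Sum>i\<in>I. f i x)"
  by (induction I rule: infinite_finite_induct) (auto intro: C1_map_const C1_map_add)

lemma C1_map_prod:
  fixes f :: "'i \<Rightarrow> 'a::real_normed_vector \<Rightarrow> real"
  shows "(\<And>i. i \<in> I \<Longrightarrow> C1_map (f i)) \<Longrightarrow> C1_map (\<lambda>x. \<Prod>i\<in>I. f i x)"
  by (induction I rule: infinite_finite_induct) (auto intro: C1_map_const C1_map_mult)

lemma C1_map_power:
  fixes f :: "'a::real_normed_vector \<Rightarrow> real"
  shows "C1_map f \<Longrightarrow> C1_map (\<lambda>x. f x ^ k)"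
  by (induction k) (auto intro: C1_map_const C1_map_mult)

text \<open>The map is the sum of its components times the standard basis vectors.\<close>
lemma C1_map_vec:
  fixes f :: "'n::finite \<Rightarrow> 'a::real_normed_vector \<Rightarrow> real"
  assumes "\<And>i. C1_map (f i)"
  shows "C1_map (\<lambda>x. \<chi> i. f i x)"
proof -
  have "(\<lambda>x. \<chi> i. f i x) = (\<lambda>x. \<Sum>i\<in>UNIV. f i x *\<^sub>R axis i (1::real))"
    by (auto simp: fun_eq_iff vec_eq_iff axis_def if_distrib cong: if_cong)
  moreover have "C1_map (\<lambda>x. f i x *\<^sub>R axis i (1::real))" for i
    by (rule C1_map_bounded_linear_compose[OF bounded_linear_scaleR_left assms])
  ultimately show ?thesis
    by (simp add: C1_map_sum)
qed

text \<open>
  An injective linear endomorphism of a finite-dimensional space has a linear left inverse, so the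
  inverse function theorem applies.
\<close>
lemma C1_map_locally_injective:
  fixes f :: "'a::euclidean_space \<Rightarrow> 'a"
  assumes "C1_map f" and inj: "inj (frechet_derivative f (at a))"
  shows "\<exists>r>0. inj_on f (ball a r)"
proof -
  obtain f' where f': "\<And>x. (f has_derivative blinfun_apply (f' x)) (at x)" "continuous_on UNIV f'"
    using assms unfolding C1_map_def by blast
  have "inj (blinfun_apply (f' a))"
    using inj frechet_derivative_at[OF f'(1)[of a]] by simp
  then obtain g where "linear g" and g: "g \<circ> blinfun_apply (f' a) = id"
    using linear_injective_left_inverse[of "blinfun_apply (f' a)"]
      bounded_linear.linear[OF blinfun.bounded_linear_right] by blast
  then have "Blinfun g o\<^sub>L f' a = id_blinfun"
    by (intro blinfun_eqI)
      (auto simp: bounded_linear_Blinfun_apply linear_conv_bounded_linear fun_eq_iff)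
  then obtain U V h where "open U" "a \<in> U" "homeomorphism U V f h"
    using inverse_function_theorem[OF open_UNIV f'(1) f'(2), of a "Blinfun g"] by (metis UNIV_I)
  moreover have "inj_on f U"
    using \<open>homeomorphism U V f h\<close> by (metis homeomorphism_apply1 inj_on_inverseI)
  ultimately show ?thesis
    by (meson inj_on_subset openE)
qed

text \<open>Hadamard's global inverse function theorem.\<close>
theorem proper_local_diffeomorphism_imp_bij:
  fixes F :: "'a::euclidean_space \<Rightarrow> 'a"
  assumes "C1_map F" and "\<And>x. inj (frechet_derivative F (at x))"
    and "LIM x at_infinity. F x :> at_infinity"
  shows "bij F"
proof (rule covering_space_simply_connected_imp_bij[OF covering_space_proper_locally_injective])
  show cont: "continuous_on UNIV F"
    by (rule C1_map_imp_continuous_on[OF assms(1)])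
  show "compact (F -` K)" if "compact K" for K
    by (rule compact_vimage_filterlim_at_infinity[OF cont assms(3) that])
  show "\<exists>r>0. inj_on F (ball x r)" for x
    by (rule C1_map_locally_injective[OF assms(1,2)])
qed

text \<open>
  An affine map has its linear part as derivative, and injective linear endomorphisms of a
  finite-dimensional space are bijective.
\<close>
lemma bij_affine:
  fixes F :: "'a::euclidean_space \<Rightarrow> 'a"
  assumes lin: "linear (\<lambda>x. F x - F 0)" and inj: "inj (frechet_derivative F (at 0))"
  shows "bij F"
proof -
  have "((\<lambda>x. (F x - F 0) + F 0) has_derivative (\<lambda>x. F x - F 0)) (at 0)"
    by (intro has_derivative_add_const linear_imp_has_derivative lin)
  then have "frechet_derivative F (at 0) = (\<lambda>x. F x - F 0)"
    by (simp flip: frechet_derivative_at)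
  with inj have "inj (\<lambda>x. F x - F 0)"
    by simp
  moreover from this have "surj (\<lambda>x. F x - F 0)"
    using linear_injective_imp_surjective[OF lin] by simp
  ultimately have "bij (\<lambda>x. F x - F 0)"
    by (simp add: bij_def)
  then have "bij ((\<lambda>y. y + F 0) \<circ> (\<lambda>x. F x - F 0))"
    by (rule bij_comp) (simp add: bij_plus_right)
  then show ?thesis
    by (simp add: o_def)
qed

section \<open>Polynomial maps and their leading forms\<close>

lemma lookup_hom_part:
  "Poly_Mapping.lookup (hom_part d p) m = (if mon_degree m = d then Poly_Mapping.lookup p m else 0)"
proof -
  let ?A = "{m \<in> Poly_Mapping.keys p. mon_degree m = d}"
  have "Poly_Mapping.lookup (hom_part d p) m = (\<Sum>k\<in>?A. if k = m then Poly_Mapping.lookup p k else 0)"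
    unfolding hom_part_def lookup_sum by (intro sum.cong) (auto simp: lookup_single when_def)
  also have "\<dots> = (if m \<in> ?A then Poly_Mapping.lookup p m else 0)"
    by (simp add: sum.delta)
  finally show ?thesis
    by (auto simp: in_keys_iff)
qed

lemma keys_hom_part: "Poly_Mapping.keys (hom_part d p) = {m \<in> Poly_Mapping.keys p. mon_degree m = d}"
  by (auto simp: in_keys_iff lookup_hom_part split: if_splits)

definition monomial_eval :: "('n::finite \<Rightarrow>\<^sub>0 nat) \<Rightarrow> real ^ 'n \<Rightarrow> real" where
  "monomial_eval m x = (\<Prod>i\<in>UNIV. (x $ i) ^ Poly_Mapping.lookup m i)"

lemma poly_eval_hom_part:
  "poly_eval (hom_part d p) x =
     (\<Sum>m\<in>{m \<in> Poly_Mapping.keys p. mon_degree m = d}. Poly_Mapping.lookup p m * monomial_eval m x)"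
  unfolding poly_eval_def keys_hom_part monomial_eval_def
  by (intro sum.cong) (auto simp: lookup_hom_part)

lemma poly_eval_monomials:
  "poly_eval p x = (\<Sum>m\<in>Poly_Mapping.keys p. Poly_Mapping.lookup p m * monomial_eval m x)"
  by (simp add: poly_eval_def monomial_eval_def)

lemma monomial_eval_scaleR: "monomial_eval m (t *\<^sub>R x) = t ^ mon_degree m * monomial_eval m x"
  by (simp add: monomial_eval_def mon_degree_def power_mult_distrib prod.distrib power_sum)

lemma poly_eval_hom_part_scaleR: "poly_eval (hom_part d p) (t *\<^sub>R x) = t ^ d * poly_eval (hom_part d p) x"
  by (auto simp: poly_eval_hom_part monomial_eval_scaleR sum_distrib_left intro!: sum.cong)

lemma abs_monomial_eval_le: "\<bar>monomial_eval m x\<bar> \<le> norm x ^ mon_degree m"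
proof -
  have "\<bar>monomial_eval m x\<bar> = (\<Prod>i\<in>UNIV. \<bar>x $ i\<bar> ^ Poly_Mapping.lookup m i)"
    by (simp add: monomial_eval_def abs_prod power_abs)
  also have "\<dots> \<le> (\<Prod>i\<in>UNIV. norm x ^ Poly_Mapping.lookup m i)"
    by (intro prod_mono conjI power_mono component_le_norm_cart) auto
  finally show ?thesis
    by (simp add: mon_degree_def power_sum)
qed

lemma C1_map_poly_eval: "C1_map (poly_eval p)"
  unfolding poly_eval_def[abs_def]
  by (intro C1_map_sum C1_map_mult C1_map_const C1_map_prod C1_map_power
      C1_map_bounded_linear bounded_linear_vec_nth)

lemma C1_map_poly_map: "C1_map (poly_map f)"
  unfolding poly_map_def[abs_def] by (intro C1_map_vec C1_map_poly_eval)

lemma mon_degree_le_alg_degree: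
  assumes "m \<in> Poly_Mapping.keys (f i)"
  shows "mon_degree m \<le> alg_degree f"
proof -
  have "mon_degree m \<le> total_degree (f i)"
    using assms by (auto simp: total_degree_def)
  also have "\<dots> \<le> alg_degree f"
    unfolding alg_degree_def by (intro Max_ge) (auto simp: full_SetCompr_eq)
  finally show ?thesis .
qed

text \<open>Such a monomial is either constant or one of the coordinates.\<close>
lemma monomial_eval_affine:
  assumes "mon_degree m \<le> 1"
  shows "linear (\<lambda>x. monomial_eval m x - monomial_eval m 0)"
proof (cases "mon_degree m")
  case 0
  then have "Poly_Mapping.lookup m i = 0" for i
    by (simp add: mon_degree_def)
  then show ?thesis
    by (simp add: monomial_eval_def linear_zero)
next
  case (Suc k)
  with assms have "(\<Sum>i\<in>UNIV. Poly_Mapping.lookup m i) = 1"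
    by (simp add: mon_degree_def)
  then obtain j where j: "Poly_Mapping.lookup m j = 1" "\<And>i. i \<noteq> j \<Longrightarrow> Poly_Mapping.lookup m i = 0"
    using sum_eq_1_iff[of UNIV "Poly_Mapping.lookup m"] by auto
  have "monomial_eval m x = x $ j" for x
  proof -
    have "monomial_eval m x = (\<Prod>i\<in>UNIV. if i = j then x $ i else 1)"
      unfolding monomial_eval_def by (intro prod.cong) (auto simp: j)
    then show ?thesis
      by simp
  qed
  then show ?thesis
    by (simp add: bounded_linear.linear[OF bounded_linear_vec_nth])
qed

lemma poly_map_affine:
  assumes "alg_degree f \<le> 1"
  shows "linear (\<lambda>x. poly_map f x - poly_map f 0)"
proof -
  have "linear (\<lambda>x. poly_eval (f i) x - poly_eval (f i) 0)" for i
  proof -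
    have "linear (\<lambda>x. \<Sum>m\<in>Poly_Mapping.keys (f i).
        Poly_Mapping.lookup (f i) m *\<^sub>R (monomial_eval m x - monomial_eval m 0))"
      using mon_degree_le_alg_degree[of _ f i] assms
      by (intro linear_compose_sum ballI linear_compose_scale_right monomial_eval_affine) (auto intro: order_trans)
    then show ?thesis
      by (simp add: poly_eval_monomials sum_subtractf right_diff_distrib)
  qed
  then show ?thesis
    by (auto simp: linear_iff poly_map_def vec_eq_iff)
qed

text \<open>
  Only monomials of degree at most \<open>d - 1\<close> remain in the difference, and outside the unit ball a
  power of the norm grows with its exponent.  If \<open>d = 0\<close>, nothing remains, so the truncated
  exponent does no harm.
\<close>
lemma poly_eval_diff_hom_part_bound:
  assumes "\<And>m. m \<in> Poly_Mapping.keys p \<Longrightarrow> mon_degree m \<le> d" and "1 \<le> norm x"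
  shows "\<bar>poly_eval p x - poly_eval (hom_part d p) x\<bar>
    \<le> (\<Sum>m\<in>Poly_Mapping.keys p. \<bar>Poly_Mapping.lookup p m\<bar>) * norm x ^ (d - 1)"
proof -
  let ?A = "{m \<in> Poly_Mapping.keys p. mon_degree m = d}"
  have "poly_eval p x - poly_eval (hom_part d p) x =
      (\<Sum>m\<in>Poly_Mapping.keys p - ?A. Poly_Mapping.lookup p m * monomial_eval m x)"
    unfolding poly_eval_monomials[of p] poly_eval_hom_part by (subst sum_diff) auto
  also have "\<bar>\<dots>\<bar> \<le> (\<Sum>m\<in>Poly_Mapping.keys p - ?A. \<bar>Poly_Mapping.lookup p m\<bar> * norm x ^ (d - 1))"
  proof (rule order_trans[OF sum_abs sum_mono])
    fix m assume m: "m \<in> Poly_Mapping.keys p - ?A"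
    have "\<bar>monomial_eval m x\<bar> \<le> norm x ^ mon_degree m"
      by (rule abs_monomial_eval_le)
    also have "\<dots> \<le> norm x ^ (d - 1)"
      using assms(1)[of m] assms(2) m by (intro power_increasing) auto
    finally show "\<bar>Poly_Mapping.lookup p m * monomial_eval m x\<bar> \<le> \<bar>Poly_Mapping.lookup p m\<bar> * norm x ^ (d - 1)"
      by (simp add: abs_mult mult_left_mono)
  qed
  also have "\<dots> \<le> (\<Sum>m\<in>Poly_Mapping.keys p. \<bar>Poly_Mapping.lookup p m\<bar> * norm x ^ (d - 1))"
    by (intro sum_mono2) auto
  finally show ?thesis
    by (simp add: sum_distrib_right)
qed

text \<open>
  Homogeneous of degree \<open>alg_degree f\<close>; components of smaller degree contribute zero.
\<close>
definition leading_form :: "('n::finite \<Rightarrow> 'n rpoly) \<Rightarrow> real ^ 'n \<Rightarrow> real ^ 'n" where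
  "leading_form f = poly_map (\<lambda>i. hom_part (alg_degree f) (f i))"

text \<open>
  The constant is the minimum of the norm on the unit sphere, which is positive because the leading
  form does not vanish there; homogeneity extends the bound to all vectors.
\<close>
lemma leading_form_lower_bound:
  fixes f :: "'n::finite \<Rightarrow> 'n rpoly"
  assumes "no_zeros_at_infinity f"
  obtains c where "c > 0" "\<And>x. c * norm x ^ alg_degree f \<le> norm (leading_form f x)"
proof -
  let ?S = "sphere (0::real^'n) 1"
  have "continuous_on ?S (\<lambda>x. norm (leading_form f x))"
    unfolding leading_form_def
    by (intro continuous_on_norm continuous_on_subset[OF C1_map_imp_continuous_on[OF C1_map_poly_map]]) auto
  moreover have "?S \<noteq> {}"
    by simp
  ultimately obtain u where u: "u \<in> ?S" "\<And>x. x \<in> ?S \<Longrightarrow> norm (leading_form f u) \<le> norm (leading_form f x)"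
    using continuous_attains_inf[of ?S "\<lambda>x. norm (leading_form f x)"] compact_sphere by blast
  show ?thesis
  proof
    have "u \<noteq> 0"
      using u(1) by auto
    then have "leading_form f u \<noteq> 0"
      using assms by (auto simp: no_zeros_at_infinity_def leading_form_def poly_map_def vec_eq_iff)
    then show "norm (leading_form f u) > 0"
      by simp
    fix x :: "real^'n"
    have scale: "leading_form f (t *\<^sub>R y) = t ^ alg_degree f *\<^sub>R leading_form f y" for t y
      by (simp add: leading_form_def poly_map_def vec_eq_iff poly_eval_hom_part_scaleR)
    \<comment> \<open>For \<open>x = 0\<close> any unit vector will do, as \<open>x\<close> is zero times it; the bound then also holds in
       degree 0, where the leading form is constant.\<close>
    define y where "y = (if x = 0 then u else x /\<^sub>R norm x)"
    have "y \<in> ?S" and x: "x = norm x *\<^sub>R y"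
      using u(1) by (auto simp: y_def)
    have "norm (leading_form f u) * norm x ^ alg_degree f \<le> norm (leading_form f y) * norm x ^ alg_degree f"
      using u(2)[OF \<open>y \<in> ?S\<close>] by (intro mult_right_mono) auto
    also have "\<dots> = norm (leading_form f (norm x *\<^sub>R y))"
      by (simp add: scale)
    finally show "norm (leading_form f u) * norm x ^ alg_degree f \<le> norm (leading_form f x)"
      using x by simp
  qed
qed

lemma poly_map_diff_leading_form_bound:
  fixes f :: "'n::finite \<Rightarrow> 'n rpoly"
  obtains C where
    "\<And>x. 1 \<le> norm x \<Longrightarrow> norm (poly_map f x - leading_form f x) \<le> C * norm x ^ (alg_degree f - 1)"
proof
  let ?C = "\<Sum>i\<in>UNIV. \<Sum>m\<in>Poly_Mapping.keys (f i). \<bar>Poly_Mapping.lookup (f i) m\<bar>"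
  fix x :: "real^'n" assume x: "1 \<le> norm x"
  have "norm (poly_map f x - leading_form f x) \<le> (\<Sum>i\<in>UNIV. \<bar>(poly_map f x - leading_form f x) $ i\<bar>)"
    by (rule norm_le_l1_cart)
  also have "\<dots> \<le> (\<Sum>i\<in>UNIV. (\<Sum>m\<in>Poly_Mapping.keys (f i). \<bar>Poly_Mapping.lookup (f i) m\<bar>)
      * norm x ^ (alg_degree f - 1))"
    using poly_eval_diff_hom_part_bound[OF mon_degree_le_alg_degree x]
    by (intro sum_mono) (simp add: poly_map_def leading_form_def)
  finally show "norm (poly_map f x - leading_form f x) \<le> ?C * norm x ^ (alg_degree f - 1)"
    by (simp add: sum_distrib_right)
qed

text \<open>
  With \<open>c\<close> from the lower bound on the leading form and \<open>C\<close> from the bound on the rest, the norm of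
  \<open>x - poly_map f x\<close> is at least \<open>c * norm x - C - 1\<close> for large \<open>x\<close>.  Degree at least 2 is what
  makes the norm of \<open>x\<close> itself a term of lower order.
\<close>
lemma filterlim_id_minus_poly_map:
  assumes "no_zeros_at_infinity f" and "2 \<le> alg_degree f"
  shows "LIM x at_infinity. x - poly_map f x :> at_infinity"
proof -
  define d where "d = alg_degree f"
  obtain c where c: "c > 0" "\<And>x. c * norm x ^ d \<le> norm (leading_form f x)"
    using leading_form_lower_bound[OF assms(1)] unfolding d_def by blast
  obtain C where C: "\<And>x. 1 \<le> norm x \<Longrightarrow> norm (poly_map f x - leading_form f x) \<le> C * norm x ^ (d - 1)"
    using poly_map_diff_leading_form_bound[of f] unfolding d_def by blast
  have bound: "c * norm x - C - 1 \<le> norm (x - poly_map f x)"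
    if "1 \<le> norm x" "C + 1 \<le> c * norm x" for x
  proof -
    have p: "norm x * 1 \<le> norm x ^ (d - 1)" "1 \<le> norm x ^ (d - 1)"
      using power_increasing[of 1 "d - 1" "norm x"] that assms(2) by (auto simp: d_def)
    have "c * norm x - C - 1 \<le> norm x ^ (d - 1) * (c * norm x - C - 1)"
      using mult_right_mono[OF p(2), of "c * norm x - C - 1"] that by simp
    also have "\<dots> = c * (norm x * norm x ^ (d - 1)) - C * norm x ^ (d - 1) - norm x ^ (d - 1)"
      by (simp add: algebra_simps)
    also have "norm x * norm x ^ (d - 1) = norm x ^ d"
      using assms(2) by (simp add: d_def flip: power_Suc)
    also have "c * norm x ^ d - C * norm x ^ (d - 1) - norm x ^ (d - 1)
        \<le> norm (leading_form f x) - norm (poly_map f x - leading_form f x) - norm x"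
      using c(2)[of x] C[OF that(1)] p(1) by simp
    also have "\<dots> \<le> norm (x - poly_map f x)"
      by norm
    finally show ?thesis .
  qed
  show ?thesis
    unfolding filterlim_at_infinity[OF order_refl]
  proof (intro allI impI)
    fix B :: real
    show "\<forall>\<^sub>F x in at_infinity. B \<le> norm (x - poly_map f x)"
      unfolding eventually_at_infinity
    proof (intro exI allI impI)
      fix x :: "real^'a"
      assume x: "max 1 ((\<bar>B\<bar> + C + 1) / c) \<le> norm x"
      then have "\<bar>B\<bar> + C + 1 \<le> c * norm x"
        using c(1) by (simp add: field_simps)
      with bound[of x] x show "B \<le> norm (x - poly_map f x)"
        by linarith
    qed
  qed
qed

section \<open>The eigenvalue condition and fixed points\<close>

text \<open>On an eigenvector for \<open>c\<close> the \<open>k\<close>-th power of the matrix acts as multiplication by \<open>c ^ k\<close>.\<close>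
lemma nilpotent_imp_not_eigenvalue:
  assumes "nilpotent A" and "c \<noteq> 0"
  shows "\<not> eigenvalue A c"
proof
  assume "eigenvalue A c"
  then obtain v where v: "v \<noteq> 0" "A *v v = c *\<^sub>R v"
    unfolding eigenvalue_def by blast
  have "(((**) A) ^^ k) (mat 1) *v v = c ^ k *\<^sub>R v" for k
    by (induction k) (simp_all add: v(2) matrix_vector_mult_scaleR flip: matrix_vector_mul_assoc)
  moreover obtain k where "(((**) A) ^^ k) (mat 1) = 0"
    using assms(1) unfolding nilpotent_def by blast
  ultimately have "c ^ k *\<^sub>R v = 0"
    by (metis matrix_vector_mult_0)
  with v(1) assms(2) show False
    by simp
qed

lemma has_derivative_poly_map:
  "(poly_map f has_derivative (\<lambda>h. jacobian (poly_map f) (at x) *v h)) (at x)"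
  using C1_map_imp_differentiable[OF C1_map_poly_map] by (simp add: jacobian_works)

text \<open>A nonzero vector in the kernel of the derivative would be an eigenvector for 1.\<close>
lemma inj_frechet_derivative_id_minus_poly_map:
  assumes "\<not> eigenvalue (jacobian (poly_map f) (at x)) 1"
  shows "inj (frechet_derivative (\<lambda>x. x - poly_map f x) (at x))"
proof -
  let ?J = "jacobian (poly_map f) (at x)"
  have der: "((\<lambda>x. x - poly_map f x) has_derivative (\<lambda>h. h - ?J *v h)) (at x)"
    by (intro has_derivative_diff has_derivative_ident has_derivative_poly_map)
  have "h = 0" if "h - ?J *v h = 0" for h
    using assms that by (auto simp: eigenvalue_def)
  then have "inj (\<lambda>h. h - ?J *v h)"
    using linear_injective_0[OF has_derivative_linear[OF der]] by blast
  then show ?thesis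
    using frechet_derivative_at[OF der] by simp
qed

lemma bij_id_minus_poly_map:
  assumes inf: "no_zeros_at_infinity f"
    and ev: "\<And>x. \<not> eigenvalue (jacobian (poly_map f) (at x)) 1"
  shows "bij (\<lambda>x. x - poly_map f x)"
proof (cases "alg_degree f \<le> 1")
  case True
  show ?thesis
  proof (rule bij_affine)
    have "linear (\<lambda>x. x - (poly_map f x - poly_map f 0))"
      by (intro linear_compose_sub linear_ident poly_map_affine True)
    then show "linear (\<lambda>x. (x - poly_map f x) - (0 - poly_map f 0))"
      by (simp add: algebra_simps)
  qed (rule inj_frechet_derivative_id_minus_poly_map[OF ev])
next
  case False
  show ?thesis
  proof (rule proper_local_diffeomorphism_imp_bij)
    have "C1_map (\<lambda>x. x + (- 1) *\<^sub>R poly_map f x)"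
      by (intro C1_map_add C1_map_bounded_linear bounded_linear_ident
          C1_map_bounded_linear_compose[OF bounded_linear_scaleR_right] C1_map_poly_map)
    then show "C1_map (\<lambda>x. x - poly_map f x)"
      by simp
    show "LIM x at_infinity. x - poly_map f x :> at_infinity"
      using False by (intro filterlim_id_minus_poly_map[OF inf]) simp
  qed (rule inj_frechet_derivative_id_minus_poly_map[OF ev])
qed

theorem theorem12p2:
  fixes f :: "'n::finite \<Rightarrow> 'n rpoly"
  assumes "no_zeros_at_infinity f"
  shows "((\<forall>x. \<not> eigenvalue (jacobian (poly_map f) (at x)) 1) \<longrightarrow> (\<exists>!x. poly_map f x = x)) \<and>
         (\<forall>x. nilpotent (jacobian (poly_map f) (at x)) \<longrightarrow>
               \<not> eigenvalue (jacobian (poly_map f) (at x)) 1)"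
proof (intro conjI impI allI)
  assume "\<forall>x. \<not> eigenvalue (jacobian (poly_map f) (at x)) 1"
  then have "bij (\<lambda>x. x - poly_map f x)"
    using bij_id_minus_poly_map[OF assms] by blast
  then have "\<exists>!x. x - poly_map f x = 0"
    by (simp only: bij_iff)
  moreover have "x - poly_map f x = 0 \<longleftrightarrow> poly_map f x = x" for x
    by auto
  ultimately show "\<exists>!x. poly_map f x = x"
    by simp
qed (rule nilpotent_imp_not_eigenvalue, auto)

end
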